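(* Let $G=G(V,E)$ be a finite simple graph and let $n\ge |V|$ be an integer. Then $$\mathrm{lbal}(n,G)\le \frac{1}{2}\binom{n}{2}+\left\lceil \frac{\mathrm{ex}(n,\mathcal{H}(G))}{2}\right\rceil .$$
   Context: A 2-list coloring of the edges of $K_n$ is a function $L:E(K_n)\to\{\{r\},\{b\},\{r,b\}\}$; it induces color classes $R=\{e: r\in L(e)\}$ and $B=\{e: b\in L(e)\}$ (which may intersect). Given a 2-list coloring with color classes $R,B$, a balanced copy of a graph $G=G(V,E)$ is a (not necessarily induced) copy of $G$ in $K_n$ whose edge set has a partition $E_1\sqcup E_2$ with $E_1\subseteq R$, $E_2\subseteq B$ and $\bigl||E_1|-|E_2|\bigr|\le 1$. For $n\ge |V|$, the list balancing number $\mathrm{lbal}(n,G)$ is the smallest integer $k$ such that every 2-list coloring of the edges of $K_n$ with color classes satisfying $|R|,|B|>k$ contains a balanced copy of $G$. Let $\mathcal{H}(G)$ be the family of all subgraphs $H$ of $G$ with exactly $e(H)=\lfloor e(G)/2\rfloor$ edges and with no isolated vertices, where $e(\cdot)$ denotes the number of edges. For a graph family $\mathcal{F}$, $\mathrm{ex}(n,\mathcal{F})$ is the largest number of edges in a graph of order $n$ that contains no member of $\mathcal{F}$ as a (not necessarily induced) subgraph. *)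

theory Defs
  imports Complex_Main
begin

text \<open>A graph is a pair of its vertex set and its edge set; edges are 2-element sets of vertices.\<close>

type_synonym 'a sgraph = "'a set \<times> 'a set set"

abbreviation verts :: "'a sgraph \<Rightarrow> 'a set" where
  "verts G \<equiv> fst G"

abbreviation edges :: "'a sgraph \<Rightarrow> 'a set set" where
  "edges G \<equiv> snd G"

definition simple_graph :: "'a sgraph \<Rightarrow> bool" where
  "simple_graph G \<longleftrightarrow> finite (verts G) \<and> (\<forall>e\<in>edges G. e \<subseteq> verts G \<and> card e = 2)"

definition subgraph :: "'a sgraph \<Rightarrow> 'a sgraph \<Rightarrow> bool" where
  "subgraph H G \<longleftrightarrow> simple_graph H \<and> verts H \<subseteq> verts G \<and> edges H \<subseteq> edges G"

definition isomorphic :: "'a sgraph \<Rightarrow> 'b sgraph \<Rightarrow> bool" where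
  "isomorphic G H \<longleftrightarrow>
     (\<exists>f. bij_betw f (verts G) (verts H) \<and> edges H = (\<lambda>e. f ` e) ` edges G)"

definition copy_in :: "'a sgraph \<Rightarrow> 'b sgraph \<Rightarrow> 'b sgraph \<Rightarrow> bool" where
  "copy_in G K C \<longleftrightarrow> subgraph C K \<and> isomorphic G C"

definition complete_graph :: "nat \<Rightarrow> nat sgraph" where
  "complete_graph n = ({..<n}, {e. e \<subseteq> {..<n} \<and> card e = 2})"

datatype color = Red | Blue

text \<open>Values of \<open>L\<close> outside the edge set of the complete graph are irrelevant:
  the color classes below only collect edges of that graph.\<close>

definition list_coloring :: "nat \<Rightarrow> (nat set \<Rightarrow> color set) \<Rightarrow> bool" where
  "list_coloring n L \<longleftrightarrow>
     (\<forall>e\<in>edges (complete_graph n). L e \<in> {{Red}, {Blue}, {Red, Blue}})"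

definition color_class :: "nat \<Rightarrow> (nat set \<Rightarrow> color set) \<Rightarrow> color \<Rightarrow> nat set set" where
  "color_class n L c = {e \<in> edges (complete_graph n). c \<in> L e}"

definition has_balanced_copy :: "nat \<Rightarrow> (nat set \<Rightarrow> color set) \<Rightarrow> 'a sgraph \<Rightarrow> bool" where
  "has_balanced_copy n L G \<longleftrightarrow>
     (\<exists>C E1 E2. copy_in G (complete_graph n) C \<and>
        E1 \<union> E2 = edges C \<and> E1 \<inter> E2 = {} \<and>
        E1 \<subseteq> color_class n L Red \<and> E2 \<subseteq> color_class n L Blue \<and>
        \<bar>int (card E1) - int (card E2)\<bar> \<le> 1)"

text \<open>The minimum ranges over nonnegative integers: if \<open>G\<close> has at most one edge, then every
  integer, however negative, has the required property, and the value is 0 here.\<close>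

definition lbal :: "nat \<Rightarrow> 'a sgraph \<Rightarrow> nat" where
  "lbal n G = (LEAST k. \<forall>L. list_coloring n L \<longrightarrow>
     card (color_class n L Red) > k \<longrightarrow> card (color_class n L Blue) > k \<longrightarrow>
     has_balanced_copy n L G)"

definition half_family :: "'a sgraph \<Rightarrow> 'a sgraph set" where
  "half_family G = {H. subgraph H G \<and> card (edges H) = card (edges G) div 2 \<and>
     (\<forall>v\<in>verts H. \<exists>e\<in>edges H. v \<in> e)}"

text \<open>The set below is always finite, so \<open>Sup\<close> is its maximum. It is empty exactly when
  every graph on \<open>n\<close> vertices contains a member of the family (for instance if the family
  contains the graph without vertices); the value is then 0.\<close>

definition ex :: "nat \<Rightarrow> 'a sgraph set \<Rightarrow> nat" where
  "ex n F = Sup {card (edges K) | K :: nat sgraph.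
     simple_graph K \<and> verts K = {..<n} \<and> \<not> (\<exists>H\<in>F. \<exists>C. copy_in H K C)}"

text \<open>The minimum in \<open>lbal\<close> and the maximum in \<open>ex\<close> are taken over a nonempty
  and a finite set, respectively.\<close>

lemma finite_edges_complete: "finite (edges (complete_graph n))"
  by (simp add: complete_graph_def)

lemma lbal_bound_exists:
  "\<exists>k. \<forall>L. list_coloring n L \<longrightarrow>
     card (color_class n L Red) > k \<longrightarrow> card (color_class n L Blue) > k \<longrightarrow>
     has_balanced_copy n L G"
proof -
  have "card (color_class n L c) \<le> card (edges (complete_graph n))" for L c
    by (rule card_mono[OF finite_edges_complete]) (auto simp: color_class_def)
  then show ?thesis
    by (meson leD)
qed

lemma finite_ex_set:
  "finite {card (edges K) | K :: nat sgraph.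
     simple_graph K \<and> verts K = {..<n} \<and> \<not> (\<exists>H\<in>F. \<exists>C. copy_in H K C)}"
proof (rule finite_subset)
  show "{card (edges K) | K :: nat sgraph.
     simple_graph K \<and> verts K = {..<n} \<and> \<not> (\<exists>H\<in>F. \<exists>C. copy_in H K C)}
     \<subseteq> {..card (edges (complete_graph n))}"
  proof
    fix x
    assume "x \<in> {card (edges K) | K :: nat sgraph.
      simple_graph K \<and> verts K = {..<n} \<and> \<not> (\<exists>H\<in>F. \<exists>C. copy_in H K C)}"
    then obtain K :: "nat sgraph" where
      x: "x = card (edges K)" and K: "simple_graph K" "verts K = {..<n}"
      by blast
    from K have "edges K \<subseteq> edges (complete_graph n)"
      by (auto simp: simple_graph_def complete_graph_def)
    then show "x \<in> {..card (edges (complete_graph n))}"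
      using x card_mono[OF finite_edges_complete] by simp
  qed
qed simp

end

theory Submission imports Defs begin

text \<open>If both color classes have more edges than the bound, then, since together they cover the
  complete graph, more than \<open>ex\<close> edges carry both colors. So the bicolored edges contain a
  copy of half of \<open>G\<close>. It extends to a copy of \<open>G\<close> by placing the remaining vertices
  arbitrarily, and its edges, whose color can be chosen freely, balance the other half.\<close>

lemma inj_on_extend:
  assumes "inj_on f A" "A \<subseteq> V" "f ` A \<subseteq> W" "finite V" "finite W" "card V \<le> card W"
  obtains g where "inj_on g V" "g ` V \<subseteq> W" "\<And>x. x \<in> A \<Longrightarrow> g x = f x"
proof -
  have "card (V - A) \<le> card (W - f ` A)"
    using assms by (simp add: card_Diff_subset finite_subset card_image)
  then obtain h where h: "inj_on h (V - A)" "h ` (V - A) \<subseteq> W - f ` A"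
    using assms by (metis card_le_inj finite_Diff)
  let ?g = "\<lambda>x. if x \<in> A then f x else h x"
  have "inj_on ?g (A \<union> (V - A))"
    using assms(1) h by (intro inj_on_disjoint_Un) auto
  then have "inj_on ?g V"
    using assms(2) by (simp add: Un_absorb1)
  moreover have "?g ` V \<subseteq> W"
    using assms(3) h(2) by (simp add: image_subset_iff)
  ultimately show ?thesis
    by (rule that) simp
qed

text \<open>Outside \<open>D\<close> the colors may be forced, but there are only
  \<open>card E - card E div 2\<close> such edges, half of \<open>E\<close> rounded up. The elements
  of \<open>D\<close> carry both colors and can top up whichever side is short.\<close>

lemma balanced_partition:
  assumes "finite E" "D \<subseteq> E" "card D = card E div 2" "D \<subseteq> R \<inter> B" "E \<subseteq> R \<union> B"
  obtains E1 E2 where "E1 \<union> E2 = E" "E1 \<inter> E2 = {}" "E1 \<subseteq> R" "E2 \<subseteq> B"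
    "\<bar>int (card E1) - int (card E2)\<bar> \<le> 1"
proof -
  define P where "P = (E - D) \<inter> R"
  have finD: "finite D"
    using assms finite_subset by blast
  have "card P \<le> card (E - D)"
    using assms(1) by (intro card_mono) (auto simp: P_def)
  then have P: "card P \<le> card E - card E div 2"
    using assms finD by (simp add: card_Diff_subset)
  have fin: "finite (P \<union> D)"
    using assms(1) finD by (simp add: P_def)
  have "card P \<le> card (P \<union> D)" "card D \<le> card (P \<union> D)"
    using fin by (auto intro: card_mono)
  \<comment> \<open>\<open>E1\<close> takes all of \<open>P\<close> and is filled from
    \<open>D\<close> up to half of \<open>E\<close> if \<open>P\<close> is smaller, which is
    possible because \<open>D\<close> alone has that size. By the bound on \<open>card P\<close>,
    the maximum is half of \<open>E\<close> rounded down or up.\<close>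
  then obtain E1 where E1: "P \<subseteq> E1" "E1 \<subseteq> P \<union> D" "card E1 = max (card P) (card E div 2)"
    using exists_subset_between[of P "max (card P) (card E div 2)" "P \<union> D"] fin assms(3)
    by auto
  have sub: "E1 \<subseteq> E"
    using E1(2) assms(2) by (auto simp: P_def)
  show ?thesis
  proof
    show "E1 \<union> (E - E1) = E" "E1 \<inter> (E - E1) = {}"
      using sub by auto
    \<comment> \<open>An element of \<open>E - E1\<close> outside \<open>D\<close> is not in
      \<open>P\<close>, hence not in \<open>R\<close>, so the cover puts it in
      \<open>B\<close>.\<close>
    show "E1 \<subseteq> R" "E - E1 \<subseteq> B"
      using E1 assms by (auto simp: P_def)
    have "card (E - E1) = card E - card E1"
      using sub assms(1) by (simp add: card_Diff_subset finite_subset)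
    then show "\<bar>int (card E1) - int (card (E - E1))\<bar> \<le> 1"
      using E1(3) P by linarith
  qed
qed

lemma finite_edges: "simple_graph G \<Longrightarrow> finite (edges G)"
  by (rule finite_subset[of _ "Pow (verts G)"]) (auto simp: simple_graph_def)

lemma copy_in_if_edges_gt_ex:
  assumes "simple_graph K" "verts K = {..<n}" "ex n F < card (edges K)"
  obtains H C where "H \<in> F" "copy_in H K C"
proof -
  have "card (edges K) \<le> ex n F" if "\<not> (\<exists>H\<in>F. \<exists>C. copy_in H K C)"
    unfolding ex_def using that assms(1,2)
    \<comment> \<open>\<open>Sup\<close> on the naturals is an upper bound only for bounded sets;
      finiteness supplies this.\<close>
    by (intro cSup_upper bdd_above_finite finite_ex_set CollectI exI[of _ K]) simp
  then show ?thesis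
    using assms(3) that by (meson leD)
qed

lemma edge_image_complete:
  assumes "inj_on g V" "g ` V \<subseteq> {..<n}" "e \<subseteq> V" "card e = 2"
  shows "g ` e \<in> edges (complete_graph n)"
  using assms by (auto simp: complete_graph_def card_image inj_on_subset)

lemma copy_in_complete_graph:
  assumes "simple_graph G" "inj_on g (verts G)" "g ` verts G \<subseteq> {..<n}"
  shows "copy_in G (complete_graph n) (g ` verts G, (`) g ` edges G)"
  unfolding copy_in_def
proof
  have "g ` e \<in> edges (complete_graph n)" if "e \<in> edges G" for e
    using that assms by (intro edge_image_complete[OF assms(2,3)]) (auto simp: simple_graph_def)
  then have sub: "(`) g ` edges G \<subseteq> edges (complete_graph n)"
    by auto
  have "g ` e \<subseteq> g ` verts G" if "e \<in> edges G" for e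
    using that assms(1) by (simp add: simple_graph_def image_mono)
  moreover have "card e = 2" if "e \<in> (`) g ` edges G" for e
    using that sub by (auto simp: complete_graph_def)
  ultimately have "simple_graph (g ` verts G, (`) g ` edges G)"
    using assms(1) by (simp add: simple_graph_def)
  then show "subgraph (g ` verts G, (`) g ` edges G) (complete_graph n)"
    using assms(3) sub by (simp add: subgraph_def complete_graph_def)
  show "isomorphic G (g ` verts G, (`) g ` edges G)"
    unfolding isomorphic_def using assms(2) by (intro exI[of _ g]) (simp add: bij_betw_def)
qed

lemma has_balanced_copy_if_bicolored_gt_ex:
  assumes G: "simple_graph G" "card (verts G) \<le> n" and L: "list_coloring n L"
    and gt: "ex n (half_family G) < card (color_class n L Red \<inter> color_class n L Blue)"
  shows "has_balanced_copy n L G"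
proof -
  let ?R = "color_class n L Red" and ?B = "color_class n L Blue"
  have "simple_graph ({..<n}, ?R \<inter> ?B)"
    by (auto simp: simple_graph_def color_class_def complete_graph_def)
  then obtain H C where H: "H \<in> half_family G" and C: "copy_in H ({..<n}, ?R \<inter> ?B) C"
    using gt by (auto elim: copy_in_if_edges_gt_ex)
  have HG: "simple_graph H" "verts H \<subseteq> verts G" "edges H \<subseteq> edges G"
    "card (edges H) = card (edges G) div 2"
    using H by (auto simp: half_family_def subgraph_def)
  obtain f where f: "bij_betw f (verts H) (verts C)" "edges C = (`) f ` edges H"
    using C by (auto simp: copy_in_def isomorphic_def)
  have CK: "verts C \<subseteq> {..<n}" "edges C \<subseteq> ?R \<inter> ?B"
    using C by (auto simp: copy_in_def subgraph_def)
  have "inj_on f (verts H)" "f ` verts H \<subseteq> {..<n}"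
    using f(1) CK(1) by (auto simp: bij_betw_def)
  \<comment> \<open>Agreement with \<open>f\<close> on \<open>verts H\<close> makes the part
    \<open>H\<close> of \<open>G\<close> land exactly on the bicolored copy
    \<open>C\<close>.\<close>
  then obtain g where g: "inj_on g (verts G)" "g ` verts G \<subseteq> {..<n}"
    "\<And>x. x \<in> verts H \<Longrightarrow> g x = f x"
    using inj_on_extend[of f "verts H" "verts G" "{..<n}"] HG(2) G
    by (auto simp: simple_graph_def)
  define E where "E = (`) g ` edges G"
  define D where "D = (`) g ` edges H"
  \<comment> \<open>Distinct edges must have distinct images, so that \<open>D\<close> is still half
    of \<open>E\<close> after the embedding.\<close>
  have "\<Union> (edges G) \<subseteq> verts G"
    using G(1) by (auto simp: simple_graph_def)
  then have inj: "inj_on ((`) g) (edges G)"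
    using g(1) by (intro inj_on_image) (rule inj_on_subset)
  have "g ` e = f ` e" if "e \<in> edges H" for e
    using that HG(1) g(3) by (intro image_cong) (auto simp: simple_graph_def)
  then have "D = edges C"
    by (simp add: D_def f(2))
  moreover have copy: "copy_in G (complete_graph n) (g ` verts G, E)"
    unfolding E_def using G(1) g(1,2) by (rule copy_in_complete_graph)
  then have "E \<subseteq> edges (complete_graph n)"
    by (auto simp: copy_in_def subgraph_def)
  then have "E \<subseteq> ?R \<union> ?B"
    using L by (fastforce simp: list_coloring_def color_class_def)
  moreover have "card D = card E div 2"
    using inj HG by (simp add: D_def E_def card_image inj_on_subset[OF inj])
  moreover have "finite E" "D \<subseteq> E"
    using finite_edges[OF G(1)] HG(3) by (auto simp: D_def E_def)
  ultimately obtain E1 E2 where "E1 \<union> E2 = E" "E1 \<inter> E2 = {}" "E1 \<subseteq> ?R" "E2 \<subseteq> ?B"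
    "\<bar>int (card E1) - int (card E2)\<bar> \<le> 1"
    using balanced_partition[of E D ?R ?B] CK(2) by metis
  then show ?thesis
    unfolding has_balanced_copy_def using copy by (metis snd_conv)
qed

text \<open>Inclusion-exclusion: no list is empty, so the two classes cover all edges of the
  complete graph.\<close>

lemma card_bicolored:
  assumes "list_coloring n L"
  shows "card (color_class n L Red) + card (color_class n L Blue) =
    (n choose 2) + card (color_class n L Red \<inter> color_class n L Blue)"
proof -
  have "color_class n L Red \<union> color_class n L Blue = edges (complete_graph n)"
    using assms by (fastforce simp: list_coloring_def color_class_def)
  moreover have "card (edges (complete_graph n)) = n choose 2"
    using n_subsets[of "{..<n}" 2] by (simp add: complete_graph_def)
  moreover have "finite (color_class n L c)" for c
    by (rule finite_subset[OF _ finite_edges_complete]) (auto simp: color_class_def)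
  ultimately show ?thesis
    by (metis card_Un_Int)
qed

theorem theorem7:
  fixes G :: "'a sgraph" and n :: nat
  assumes "simple_graph G" and "card (verts G) \<le> n"
  shows "real (lbal n G) \<le> 1 / 2 * real (n choose 2) +
           real_of_int \<lceil>real (ex n (half_family G)) / 2\<rceil>"
proof -
  define x where "x = ex n (half_family G)"
  \<comment> \<open>The first half is rounded down, the second up. Two classes of size at least
    \<open>k + 1\<close> have total size at least \<open>2 * k + 2\<close>, which is at least
    \<open>(n choose 2) + x + 1\<close>: the strict inequalities absorb the rounding down, and more
    than \<open>x\<close> edges are bicolored.\<close>
  define k where "k = (n choose 2) div 2 + (x + 1) div 2"
  have "has_balanced_copy n L G"
    if "list_coloring n L" "card (color_class n L Red) > k" "card (color_class n L Blue) > k" for L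
  proof (rule has_balanced_copy_if_bicolored_gt_ex[OF assms that(1)])
    show "ex n (half_family G) < card (color_class n L Red \<inter> color_class n L Blue)"
      using card_bicolored[OF that(1)] that(2,3) unfolding k_def x_def by linarith
  qed
  then have "lbal n G \<le> k"
    unfolding lbal_def by (intro Least_le) blast
  moreover have "int ((x + 1) div 2) \<le> \<lceil>real x / 2\<rceil>"
    by linarith
  moreover have "real ((n choose 2) div 2) \<le> 1 / 2 * real (n choose 2)"
    by linarith
  ultimately show ?thesis
    unfolding k_def x_def by linarith
qed

end
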